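(* Let $k$ be an algebraically closed field and let $T_{a,b,c,d}:(\mathbb{P}^2)^{\mathbb{Z}}\dashrightarrow(\mathbb{P}^2)^{\mathbb{Z}}$ be an equal-length skew pentagram map over $k$, written in the form $a<b$ and $c<d$ (so $a,b,c,d\in\mathbb{Z}$ are distinct and $b-a=d-c$). Then, as lattice maps, $$T_{a,b,c,d}^{-1}=T_{-d,-b,-c,-a}.$$
   Context: $\operatorname{Ind}$ denotes the indeterminacy locus of a rational map. A local rule on $(\mathbb{P}^N)^{\mathbb{Z}}$ is a finite nonempty set $S\subset\mathbb{Z}$ (a neighborhood) with a rational map $\varphi:(\mathbb{P}^N)^S\dashrightarrow\mathbb{P}^N$. The associated lattice map is the partially defined map $T_\varphi:(\mathbb{P}^N)^{\mathbb{Z}}\dashrightarrow(\mathbb{P}^N)^{\mathbb{Z}}$, $(v_i)_{i}\mapsto(\varphi(v_{i+s}:s\in S))_{i}$. For finite nonempty $A\subset\mathbb{Z}$, the regional map $\varphi_A:(\mathbb{P}^N)^{A+S}\dashrightarrow(\mathbb{P}^N)^A$ is $v\mapsto(\varphi(v_{i+s}:s\in S))_{i\in A}$, where $A+S$ is the Minkowski sum. Two local rules are equivalent if they define the same lattice map. If $T,T'$ have local rules $(S,\varphi),(S',\varphi')$ and the image of $\varphi_{S'}$ is not contained in $\operatorname{Ind}\varphi'$, then $T'$ and $T$ are composable and $T'\circ T$ is the lattice map with local rule $\varphi'\circ\varphi_{S'}$ on $S+S'$ (its domain may be larger than that of the naive composition of partial maps). $T$ and $T'$ are inverses, written $T'=T^{-1}$,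 if they are composable in both orders and $T'\circ T=T\circ T'=\mathrm{Id}$ as lattice maps. For distinct $a,b,c,d\in\mathbb{Z}$, the skew pentagram map $T_{a,b,c,d}$ is the lattice map on $(\mathbb{P}^2)^{\mathbb{Z}}$ with $S=\{a,b,c,d\}$ sending $(v_i)$ to $(v_i')$ with $v_i'=\overline{v_{i+a}v_{i+b}}\cap\overline{v_{i+c}v_{i+d}}$, where $\overline{pq}$ is the line through distinct points $p,q$. It is equal-length if $|b-a|=|d-c|$. *)

theory Defs
  imports "HOL-Analysis.Analysis" "HOL-Computational_Algebra.Polynomial"
begin

section \<open>Projective space\<close>

text \<open>
  The space P^N over a field, where the index type has N + 1 elements: a point is a
  one-dimensional linear subspace of the space of (N + 1)-tuples.
\<close>

typedef (overloaded) ('a::field, 'n::finite) proj_space =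
  "{L :: ('a ^ 'n) set. \<exists>x. x \<noteq> 0 \<and> L = vec.span {x}}"
proof -
  have "(vec_lambda (\<lambda>i. 1)) \<noteq> (0 :: 'a ^ 'n)"
    by (simp add: vec_eq_iff)
  then show ?thesis by blast
qed

text \<open>\<open>proj_point x\<close> is the point with homogeneous coordinates \<open>x\<close>; it is meaningful only
  for \<open>x \<noteq> 0\<close>.\<close>

definition proj_point :: "('a::field) ^ ('n::finite) \<Rightarrow> ('a, 'n) proj_space" where
  "proj_point x = Abs_proj_space (vec.span {x})"

definition hom_coords :: "('a::field, 'n::finite) proj_space \<Rightarrow> 'a ^ 'n" where
  "hom_coords p = (SOME x. x \<noteq> 0 \<and> proj_point x = p)"

definition proj_line ::
  "('a::field, 'n::finite) proj_space \<Rightarrow> ('a, 'n) proj_space \<Rightarrow> ('a, 'n) proj_space set" where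
  "proj_line p q = {r. Rep_proj_space r \<subseteq> vec.span (Rep_proj_space p \<union> Rep_proj_space q)}"


section \<open>Rational maps on products of projective spaces\<close>

text \<open>
  Points of the product of copies of P^N indexed by \<open>S\<close> are the elements of
  \<open>S \<rightarrow>\<^sub>E UNIV\<close>.  The polynomials below have variables \<open>x s $ j\<close> with \<open>s \<in> S\<close>; they are treated
  as functions, which loses nothing over an infinite field, in particular over an
  algebraically closed one.
\<close>

definition multihomogeneous ::
  "int set \<Rightarrow> (int \<Rightarrow> nat) \<Rightarrow> ((int \<Rightarrow> ('a::field) ^ ('n::finite)) \<Rightarrow> 'a) \<Rightarrow> bool" where
  "multihomogeneous S d F \<longleftrightarrow>
     (\<exists>(E :: (int \<Rightarrow> 'n \<Rightarrow> nat) set) c. finite E \<and>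
        (\<forall>e\<in>E. \<forall>s\<in>S. (\<Sum>j\<in>UNIV. e s j) = d s) \<and>
        F = (\<lambda>x. \<Sum>e\<in>E. c e * (\<Prod>s\<in>S. \<Prod>j\<in>UNIV. (x s $ j) ^ e s j)))"

text \<open>All components of the tuple have the same multidegree.\<close>

definition multihom_tuple ::
  "int set \<Rightarrow> ((int \<Rightarrow> ('a::field) ^ ('n::finite)) \<Rightarrow> 'a ^ 'n) \<Rightarrow> bool" where
  "multihom_tuple S G \<longleftrightarrow> (\<exists>d. \<forall>j. multihomogeneous S d (\<lambda>x. G x $ j))"

text \<open>The partial map given by a tuple, defined where the components have no common zero.  For a
  multihomogeneous tuple it does not depend on the coordinates chosen by \<open>hom_coords\<close>.\<close>

definition tuple_map ::
  "int set \<Rightarrow> ((int \<Rightarrow> ('a::field) ^ ('n::finite)) \<Rightarrow> 'a ^ 'n) \<Rightarrow>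
    (int \<Rightarrow> ('a, 'n) proj_space) \<rightharpoonup> ('a, 'n) proj_space" where
  "tuple_map S G v =
     (if v \<in> S \<rightarrow>\<^sub>E UNIV \<and> G (hom_coords \<circ> v) \<noteq> 0
      then Some (proj_point (G (hom_coords \<circ> v))) else None)"

definition represents ::
  "int set \<Rightarrow> ((int \<Rightarrow> ('a::field) ^ ('n::finite)) \<Rightarrow> 'a ^ 'n) \<Rightarrow>
    ((int \<Rightarrow> ('a, 'n) proj_space) \<rightharpoonup> ('a, 'n) proj_space) \<Rightarrow> bool" where
  "represents S G g \<longleftrightarrow> multihom_tuple S G \<and>
     (\<forall>v \<in> dom (tuple_map S G) \<inter> dom g. tuple_map S G v = g v)"

text \<open>
  A rational map is identified with the partial map on its largest domain of definition, so that
  its indeterminacy locus is the complement of \<open>dom\<close> in \<open>S \<rightarrow>\<^sub>E UNIV\<close>.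

  \<open>rational_extension S g\<close> is the rational map determined by \<open>g\<close>.  It is meant for a \<open>g\<close> that is
  given by polynomials locally on a nonempty Zariski open set.  The coordinate ring of the product
  being factorial, that rational map is regular at \<open>v\<close> iff one of the multihomogeneous tuples
  representing it does not vanish at \<open>v\<close>; all such tuples give the same value at \<open>v\<close>.
\<close>

definition rational_extension ::
  "int set \<Rightarrow> ((int \<Rightarrow> ('a::field, 'n::finite) proj_space) \<rightharpoonup> ('a, 'n) proj_space) \<Rightarrow>
    (int \<Rightarrow> ('a, 'n) proj_space) \<rightharpoonup> ('a, 'n) proj_space" where
  "rational_extension S g v =
     (if \<exists>G. represents S G g \<and> v \<in> dom (tuple_map S G)
      then Some (THE p. \<exists>G. represents S G g \<and> tuple_map S G v = Some p)
      else None)"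

definition rational_map ::
  "int set \<Rightarrow> ((int \<Rightarrow> ('a::field, 'n::finite) proj_space) \<rightharpoonup> ('a, 'n) proj_space) \<Rightarrow> bool" where
  "rational_map S f \<longleftrightarrow>
     (\<exists>F. multihom_tuple S F \<and> dom (tuple_map S F) \<noteq> {} \<and>
          f = rational_extension S (tuple_map S F))"

definition Ind ::
  "int set \<Rightarrow> ((int \<Rightarrow> ('a::field, 'n::finite) proj_space) \<rightharpoonup> ('a, 'n) proj_space) \<Rightarrow>
    (int \<Rightarrow> ('a, 'n) proj_space) set" where
  "Ind S f = (S \<rightarrow>\<^sub>E UNIV) - dom f"


section \<open>Local rules and lattice maps\<close>

type_synonym ('a, 'n) local_rule =
  "int set \<times> ((int \<Rightarrow> ('a, 'n) proj_space) \<rightharpoonup> ('a, 'n) proj_space)"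

definition local_rule :: "('a::field, 'n::finite) local_rule \<Rightarrow> bool" where
  "local_rule R \<longleftrightarrow> finite (fst R) \<and> fst R \<noteq> {} \<and> rational_map (fst R) (snd R)"

definition window :: "int set \<Rightarrow> (int \<Rightarrow> 'p) \<Rightarrow> int \<Rightarrow> int \<Rightarrow> 'p" where
  "window S v i = (\<lambda>s\<in>S. v (i + s))"

definition lattice_map ::
  "('a::field, 'n::finite) local_rule \<Rightarrow>
    (int \<Rightarrow> ('a, 'n) proj_space) \<rightharpoonup> (int \<Rightarrow> ('a, 'n) proj_space)" where
  "lattice_map = (\<lambda>(S, \<phi>) v.
     if \<forall>i. window S v i \<notin> Ind S \<phi>
     then Some (\<lambda>i. the (\<phi> (window S v i))) else None)"

text \<open>\<open>A + S\<close> is the Minkowski sum.\<close>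

definition regional_map ::
  "('a::field, 'n::finite) local_rule \<Rightarrow> int set \<Rightarrow>
    (int \<Rightarrow> ('a, 'n) proj_space) \<rightharpoonup> (int \<Rightarrow> ('a, 'n) proj_space)" where
  "regional_map = (\<lambda>(S, \<phi>) A v.
     if v \<in> (A + S) \<rightarrow>\<^sub>E UNIV \<and> (\<forall>i\<in>A. window S v i \<notin> Ind S \<phi>)
     then Some (\<lambda>i\<in>A. the (\<phi> (window S v i))) else None)"

text \<open>In the next two definitions the rule applied second comes first, as in \<open>T' \<circ> T\<close>.\<close>

definition composable ::
  "('a::field, 'n::finite) local_rule \<Rightarrow> ('a, 'n) local_rule \<Rightarrow> bool" where
  "composable = (\<lambda>(S', \<phi>') (S, \<phi>).
     \<not> ran (regional_map (S, \<phi>) S') \<subseteq> Ind S' \<phi>')"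

definition compose_rule ::
  "('a::field, 'n::finite) local_rule \<Rightarrow> ('a, 'n) local_rule \<Rightarrow> ('a, 'n) local_rule" where
  "compose_rule = (\<lambda>(S', \<phi>') (S, \<phi>).
     (S + S', rational_extension (S + S') (\<phi>' \<circ>\<^sub>m regional_map (S, \<phi>) S')))"

text \<open>\<open>Some\<close> is the identity lattice map, defined everywhere.\<close>

definition inverse_lattice_maps ::
  "('a::field, 'n::finite) local_rule \<Rightarrow> ('a, 'n) local_rule \<Rightarrow> bool" where
  "inverse_lattice_maps R R' \<longleftrightarrow>
     local_rule R \<and> local_rule R' \<and>
     composable R' R \<and> composable R R' \<and>
     lattice_map (compose_rule R' R) = Some \<and>
     lattice_map (compose_rule R R') = Some"


section \<open>Skew pentagram maps\<close>

definition line_meet ::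
  "('a::field, 3) proj_space \<Rightarrow> ('a, 3) proj_space \<Rightarrow> ('a, 3) proj_space \<Rightarrow> ('a, 3) proj_space \<Rightarrow>
    ('a, 3) proj_space option" where
  "line_meet p q r s =
     (if p \<noteq> q \<and> r \<noteq> s \<and> is_singleton (proj_line p q \<inter> proj_line r s)
      then Some (the_elem (proj_line p q \<inter> proj_line r s)) else None)"

definition skew_pentagram ::
  "int \<Rightarrow> int \<Rightarrow> int \<Rightarrow> int \<Rightarrow> ('a::field, 3) local_rule" where
  "skew_pentagram a b c d =
     ({a, b, c, d},
      rational_extension {a, b, c, d} (\<lambda>v. line_meet (v a) (v b) (v c) (v d)))"

end

theory Submission
  imports Defs
begin

text \<open>
  Write \<open>v'\<close> for the image of \<open>v\<close> under the map with parameters \<open>a, b, c, d\<close>, where \<open>b - a = d - c\<close>.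
  The points \<open>v'\<close> with indices \<open>i - d\<close> and \<open>i - b\<close> both lie on the line through \<open>v\<close> at \<open>i + c - d\<close>
  and at \<open>i\<close>, because \<open>a - b = c - d\<close>. Likewise those with indices \<open>i - c\<close> and \<open>i - a\<close> both lie on
  the line through \<open>v\<close> at \<open>i\<close> and at \<open>i + d - c\<close>. For generic \<open>v\<close> these two lines meet only in the point
  of \<open>v\<close> at \<open>i\<close>, so that the map with parameters \<open>- d, - b, - c, - a\<close> returns it. In
  homogeneous coordinates this is the identity \<open>meet_tuple_regional_tuple\<close>: the composite of the
  two coordinate formulas is the projection to one point, multiplied by three determinants. Passing
  to these parameters is an involution that preserves the equality of lengths, so the other
  composition is the same statement.

  The rest of the work relates the formulas to rational maps on their largest domains.
  First, the three determinants must not vanish identically, in spite of possible coincidences among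
  the nine indices involved (\<open>ex_meet_tuple_regional_tuple_nonzero\<close>). Secondly, a value
  of the composite may arise at a point where the formulas vanish and other representatives
  have to be used. These are parallel to the formulas at generic points; being parallel is a polynomial
  identity, so it holds everywhere (\<open>represents_parallel\<close>,
  \<open>composite_value_parallel\<close>). Hence the composite agrees with the projection wherever it is defined,
  and its extension to the largest domain is the projection itself.

  Zariski density enters only through \<open>line_poly_vanishes\<close>, which is proved by restriction to lines.
\<close>

section \<open>Points of projective space and their homogeneous coordinates\<close>

text \<open>
  Proportionality is expressed by the vanishing of the 2 by 2 minors, because this turns "two tuples
  define the same point" into polynomial identities, which extend from generic points to all points.
  The zero vector counts as parallel to everything.
\<close>

definition parallel :: "('a::field) ^ ('n::finite) \<Rightarrow> 'a ^ 'n \<Rightarrow> bool" where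
  "parallel u v \<longleftrightarrow> (\<forall>j k. u $ j * v $ k = u $ k * v $ j)"

lemma parallel_commute: "parallel u v \<longleftrightarrow> parallel v u"
  by (auto simp: parallel_def mult.commute)

lemma parallel_zero [simp]: "parallel 0 v" "parallel v 0"
  by (simp_all add: parallel_def)

lemma parallel_scale_right: "c \<noteq> 0 \<Longrightarrow> parallel u (c *s v) \<longleftrightarrow> parallel u v"
  by (simp add: parallel_def)

lemma parallel_scale_left: "c \<noteq> 0 \<Longrightarrow> parallel (c *s u) v \<longleftrightarrow> parallel u v"
  by (simp add: parallel_def)

lemma parallel_imp_scale:
  assumes "parallel u v" "v \<noteq> 0"
  obtains c where "u = c *s v"
proof -
  obtain k where k: "v $ k \<noteq> 0"
    using assms(2) by (auto simp: vec_eq_iff)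
  have "u = (u $ k / v $ k) *s v"
    using assms(1) k by (simp add: vec_eq_iff parallel_def field_simps)
  then show ?thesis by (rule that)
qed

lemma parallel_trans:
  assumes "parallel u v" "parallel v w" "v \<noteq> 0"
  shows "parallel u w"
  using parallel_imp_scale[OF assms(1,3)] assms(2)
  by (metis parallel_scale_left parallel_zero(1) vector_smult_lzero)

lemma Rep_proj_point: "x \<noteq> 0 \<Longrightarrow> Rep_proj_space (proj_point x) = vec.span {x}"
  unfolding proj_point_def by (rule Abs_proj_space_inverse) auto

lemma proj_point_scale:
  assumes "c \<noteq> 0" shows "proj_point (c *s x) = proj_point x"
proof -
  have "vec.span {c *s x} = vec.span {x}"
  proof (rule vec.span_eq[THEN iffD2], intro conjI)
    show "{c *s x} \<subseteq> vec.span {x}"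
      by (simp add: vec.span_scale vec.span_base)
    have "inverse c *s (c *s x) \<in> vec.span {c *s x}"
      by (intro vec.span_scale vec.span_base) simp
    then show "{x} \<subseteq> vec.span {c *s x}"
      using assms by (simp add: vector_smult_assoc)
  qed
  then show ?thesis by (simp add: proj_point_def)
qed

lemma proj_point_eq_iff:
  assumes "x \<noteq> 0" "y \<noteq> 0"
  shows "proj_point x = proj_point y \<longleftrightarrow> parallel x y"
proof
  assume "proj_point x = proj_point y"
  then have "vec.span {x} = vec.span {y}"
    using assms by (metis Rep_proj_point)
  then have "x \<in> vec.span {y}"
    by (metis vec.span_base singletonI)
  then obtain c where "x = c *s y"
    by (auto simp: vec.span_singleton)
  then show "parallel x y"
    by (simp add: parallel_def mult_ac)
next
  assume "parallel x y"
  then obtain c where c: "x = c *s y"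
    using assms(2) parallel_imp_scale by blast
  with assms have "c \<noteq> 0" by auto
  then show "proj_point x = proj_point y"
    using c by (simp add: proj_point_scale)
qed

lemma ex_proj_point: "\<exists>x. x \<noteq> 0 \<and> proj_point x = p"
proof -
  have "Rep_proj_space p \<in> {L. \<exists>x. x \<noteq> 0 \<and> L = vec.span {x}}"
    by (rule Rep_proj_space)
  then obtain x where "x \<noteq> 0" "Rep_proj_space p = vec.span {x}"
    by blast
  then show ?thesis
    by (metis Rep_proj_space_inverse proj_point_def)
qed

lemma hom_coords_nonzero [simp]: "hom_coords p \<noteq> 0"
  and proj_point_hom_coords [simp]: "proj_point (hom_coords p) = p"
  using someI_ex[OF ex_proj_point[of p]] by (simp_all add: hom_coords_def)

lemma hom_coords_proj_point:
  assumes "x \<noteq> 0"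
  obtains c where "c \<noteq> 0" "hom_coords (proj_point x) = c *s x"
proof -
  have "parallel (hom_coords (proj_point x)) x"
    using proj_point_eq_iff[of "hom_coords (proj_point x)" x] assms by simp
  then obtain c where c: "hom_coords (proj_point x) = c *s x"
    using assms parallel_imp_scale by blast
  moreover have "c \<noteq> 0"
    using c hom_coords_nonzero[of "proj_point x"] by auto
  ultimately show ?thesis using that by blast
qed


section \<open>Polynomial functions\<close>

text \<open>
  Polynomial functions enter through their restrictions to affine lines, which are polynomials in
  one variable. This property is closed under the
  ring operations and under the substitutions made below, and it lets the integral domain
  property be read off from univariate polynomials.
\<close>

definition line_poly :: "((int \<Rightarrow> ('a::field) ^ ('n::finite)) \<Rightarrow> 'a) \<Rightarrow> bool" where
  "line_poly F \<longleftrightarrow> (\<forall>x y. \<exists>p. \<forall>t. F (\<lambda>s. x s + t *s y s) = poly p t)"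

lemma line_poly_const: "line_poly (\<lambda>x. c)"
  unfolding line_poly_def by (metis poly_pCons poly_0 mult_zero_right add_0_right)

lemma line_poly_coord: "line_poly (\<lambda>x. x s $ j)"
  unfolding line_poly_def
proof (intro allI)
  fix x y :: "int \<Rightarrow> 'a ^ 'b"
  show "\<exists>p. \<forall>t. (x s + t *s y s) $ j = poly p t"
    by (rule exI[of _ "[:x s $ j, y s $ j:]"]) simp
qed

lemma line_poly_add:
  "line_poly F \<Longrightarrow> line_poly G \<Longrightarrow> line_poly (\<lambda>x. F x + G x)"
  unfolding line_poly_def by (metis poly_add)

lemma line_poly_diff:
  "line_poly F \<Longrightarrow> line_poly G \<Longrightarrow> line_poly (\<lambda>x. F x - G x)"
  unfolding line_poly_def by (metis poly_diff)

lemma line_poly_mult: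
  "line_poly F \<Longrightarrow> line_poly G \<Longrightarrow> line_poly (\<lambda>x. F x * G x)"
  unfolding line_poly_def by (metis poly_mult)

lemma line_poly_power: "line_poly F \<Longrightarrow> line_poly (\<lambda>x. F x ^ n)"
  by (induction n) (simp_all add: line_poly_const line_poly_mult)

lemma line_poly_sum:
  "(\<And>i. i \<in> I \<Longrightarrow> line_poly (F i)) \<Longrightarrow> line_poly (\<lambda>x. \<Sum>i\<in>I. F i x)"
  by (induction I rule: infinite_finite_induct)
    (simp_all add: line_poly_const line_poly_add line_poly_mult)

lemma line_poly_prod:
  "(\<And>i. i \<in> I \<Longrightarrow> line_poly (F i)) \<Longrightarrow> line_poly (\<lambda>x. \<Prod>i\<in>I. F i x)"
  by (induction I rule: infinite_finite_induct)
    (simp_all add: line_poly_const line_poly_add line_poly_mult)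

text \<open>
  If the field were finite, one plus the product of all linear factors \<open>X - a\<close> would be a
  nonconstant polynomial without a root.
\<close>

lemma infinite_alg_closed: "infinite (UNIV :: 'a::alg_closed_field set)"
proof
  assume fin: "finite (UNIV :: 'a set)"
  define q :: "'a poly" where "q = (\<Prod>a\<in>UNIV. [:- a, 1:])"
  have deg: "degree q = card (UNIV :: 'a set)"
    unfolding q_def by (subst degree_prod_eq_sum_degree) auto
  have "degree (q + 1) = degree q"
    by (rule degree_add_eq_left) (use fin deg in \<open>simp add: card_gt_0_iff\<close>)
  then have "degree (q + 1) > 0"
    using fin deg by (simp add: card_gt_0_iff)
  then obtain x where "poly (q + 1) x = 0"
    using alg_closed_imp_poly_has_root by blast
  moreover have "poly q x = 0"
    unfolding q_def using fin by (auto simp: poly_prod)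
  ultimately show False by simp
qed

text \<open>
  On the line that joins a nonzero of \<open>F\<close> to a nonzero of \<open>G\<close> both become nonzero polynomials in
  one variable, and an infinite field has a point that is a root of neither.
\<close>

lemma line_poly_common_nonzero:
  fixes F G :: "(int \<Rightarrow> ('a::alg_closed_field) ^ ('n::finite)) \<Rightarrow> 'a"
  assumes "line_poly F" "line_poly G" "F x \<noteq> 0" "G y \<noteq> 0"
  shows "\<exists>z. F z * G z \<noteq> 0"
proof -
  let ?l = "\<lambda>t s. x s + t *s (y s - x s)"
  obtain p q where p: "\<And>t. F (?l t) = poly p t" and q: "\<And>t. G (?l t) = poly q t"
    using assms(1,2)[unfolded line_poly_def, rule_format, of x "\<lambda>s. y s - x s"] by metis
  have "poly p 0 \<noteq> 0" "poly q 1 \<noteq> 0"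
    using assms(3,4) by (simp_all flip: p q)
  then have "p * q \<noteq> 0" by auto
  then have "finite {t. poly (p * q) t = 0}"
    by (rule poly_roots_finite)
  then obtain t where "poly (p * q) t \<noteq> 0"
    using infinite_alg_closed by (metis (mono_tags, lifting) UNIV_eq_I mem_Collect_eq)
  then show ?thesis
    by (metis p q poly_mult)
qed

text \<open>
  Nonempty Zariski open sets are dense: were \<open>E\<close> not identically zero, its product with the \<open>F i\<close>
  would be nonzero at some point, where \<open>van\<close> gives a contradiction.
\<close>

lemma line_poly_vanishes:
  fixes E :: "(int \<Rightarrow> ('a::alg_closed_field) ^ ('n::finite)) \<Rightarrow> 'a"
  assumes "line_poly E" "finite I"
    and F: "\<And>i. i \<in> I \<Longrightarrow> line_poly (F i)" "\<And>i. i \<in> I \<Longrightarrow> \<exists>x. F i x \<noteq> 0"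
    and van: "\<And>x. (\<And>i. i \<in> I \<Longrightarrow> F i x \<noteq> 0) \<Longrightarrow> E x = 0"
  shows "E x = 0"
proof (rule ccontr)
  assume "E x \<noteq> 0"
  have "\<exists>z. E z * (\<Prod>i\<in>I. F i z) \<noteq> 0"
    using assms(2) F
  proof (induction I)
    case empty
    then show ?case using \<open>E x \<noteq> 0\<close> by auto
  next
    case (insert i I)
    from insert.IH insert.prems obtain z where z: "E z * (\<Prod>i\<in>I. F i z) \<noteq> 0"
      by blast
    obtain y where "F i y \<noteq> 0" using insert.prems by blast
    moreover have "line_poly (\<lambda>z. E z * (\<Prod>i\<in>I. F i z))"
      by (intro line_poly_mult line_poly_prod assms(1) insert.prems) simp
    moreover have "line_poly (F i)" using insert.prems by blast
    ultimately obtain z where "E z * (\<Prod>i\<in>I. F i z) * F i z \<noteq> 0"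
      using line_poly_common_nonzero[of "\<lambda>z. E z * (\<Prod>i\<in>I. F i z)" "F i" z y] z by blast
    then show ?case using insert.hyps by (intro exI[of _ z]) auto
  qed
  then obtain z where z: "E z * (\<Prod>i\<in>I. F i z) \<noteq> 0" ..
  then have "\<And>i. i \<in> I \<Longrightarrow> F i z \<noteq> 0"
    using assms(2) by auto
  then have "E z = 0" by (rule van)
  then show False using z by simp
qed


section \<open>Multihomogeneous tuples\<close>

lemma line_poly_multihomogeneous:
  assumes "multihomogeneous S d F" and "\<And>s j. line_poly (\<lambda>x. Y x s $ j)"
  shows "line_poly (\<lambda>x. F (Y x))"
proof -
  obtain E and c :: "(int \<Rightarrow> 'b \<Rightarrow> nat) \<Rightarrow> 'a" where
    "F = (\<lambda>x. \<Sum>e\<in>E. c e * (\<Prod>s\<in>S. \<Prod>j\<in>UNIV. (x s $ j) ^ e s j))"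
    using assms(1) unfolding multihomogeneous_def by blast
  then show ?thesis
    by (auto intro!: line_poly_sum line_poly_prod line_poly_mult line_poly_const
        line_poly_power assms(2))
qed

lemma multihomogeneous_scale:
  assumes "multihomogeneous S d F" and y: "\<And>s. s \<in> S \<Longrightarrow> y s = l s *s x s"
  shows "F y = (\<Prod>s\<in>S. l s ^ d s) * F x"
proof -
  obtain E and c :: "(int \<Rightarrow> 'b \<Rightarrow> nat) \<Rightarrow> 'a" where
    d: "\<forall>e\<in>E. \<forall>s\<in>S. (\<Sum>j\<in>UNIV. e s j) = d s"
    and F: "F = (\<lambda>x. \<Sum>e\<in>E. c e * (\<Prod>s\<in>S. \<Prod>j\<in>UNIV. (x s $ j) ^ e s j))"
    using assms(1) unfolding multihomogeneous_def by blast
  have *: "(\<Prod>s\<in>S. \<Prod>j\<in>UNIV. (y s $ j) ^ e s j) =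
      (\<Prod>s\<in>S. l s ^ d s) * (\<Prod>s\<in>S. \<Prod>j\<in>UNIV. (x s $ j) ^ e s j)" if "e \<in> E" for e
  proof -
    have "(\<Prod>j\<in>UNIV. (y s $ j) ^ e s j) = l s ^ d s * (\<Prod>j\<in>UNIV. (x s $ j) ^ e s j)"
      if "s \<in> S" for s
    proof -
      have "(\<Prod>j\<in>UNIV. (y s $ j) ^ e s j) = (\<Prod>j\<in>UNIV. l s ^ e s j * (x s $ j) ^ e s j)"
        using y[OF that] by (simp add: power_mult_distrib)
      also have "\<dots> = l s ^ (\<Sum>j\<in>UNIV. e s j) * (\<Prod>j\<in>UNIV. (x s $ j) ^ e s j)"
        by (simp add: prod.distrib power_sum)
      finally show ?thesis using d \<open>e \<in> E\<close> that by simp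
    qed
    then show ?thesis by (simp flip: prod.distrib)
  qed
  show ?thesis
    unfolding F sum_distrib_left by (rule sum.cong) (use * in \<open>simp_all add: mult_ac\<close>)
qed

text \<open>
  Rescaling the homogeneous coordinates of each point multiplies all components by the same
  factor, since they share their multidegree.
\<close>

lemma multihom_tuple_scale:
  assumes "multihom_tuple S G" "finite S" and "\<And>s. s \<in> S \<Longrightarrow> l s \<noteq> 0"
    and y: "\<And>s. s \<in> S \<Longrightarrow> y s = l s *s x s"
  obtains c where "c \<noteq> 0" "G y = c *s G x"
proof -
  obtain d where d: "\<And>j. multihomogeneous S d (\<lambda>x. G x $ j)"
    using assms(1) unfolding multihom_tuple_def by blast
  have "G y = (\<Prod>s\<in>S. l s ^ d s) *s G x"
    using multihomogeneous_scale[OF d y] by (simp add: vec_eq_iff)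
  moreover have "(\<Prod>s\<in>S. l s ^ d s) \<noteq> 0"
    using assms(2,3) by simp
  ultimately show ?thesis using that by blast
qed

lemma multihom_tuple_cong:
  assumes "multihom_tuple S G" and "\<And>s. s \<in> S \<Longrightarrow> y s = x s"
  shows "G y = G x"
proof -
  obtain d where d: "\<And>j. multihomogeneous S d (\<lambda>x. G x $ j)"
    using assms(1) unfolding multihom_tuple_def by blast
  have "G y = (\<Prod>s\<in>S. 1 ^ d s) *s G x"
    using multihomogeneous_scale[OF d, of y "\<lambda>_. 1" x] assms(2) by (simp add: vec_eq_iff)
  then show ?thesis by simp
qed

lemma line_poly_multihom_tuple:
  assumes "multihom_tuple S G" and "\<And>s j. line_poly (\<lambda>x. Y x s $ j)"
  shows "line_poly (\<lambda>x. G (Y x) $ j)"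
  using assms line_poly_multihomogeneous[of S _ "\<lambda>x. G x $ j" Y] unfolding multihom_tuple_def
  by blast

text \<open>
  Whether the tuple vanishes, and the point that it gives, can be computed in any homogeneous
  coordinates, not only in those chosen by \<open>hom_coords\<close>.
\<close>

lemma tuple_map_proj_point:
  assumes G: "multihom_tuple S G" "finite S" and x: "\<And>s. s \<in> S \<Longrightarrow> x s \<noteq> 0"
  shows "tuple_map S G (\<lambda>s\<in>S. proj_point (x s)) =
    (if G x \<noteq> 0 then Some (proj_point (G x)) else None)"
proof -
  let ?v = "\<lambda>s\<in>S. proj_point (x s)"
  have "\<exists>c. c \<noteq> 0 \<and> hom_coords (?v s) = c *s x s" if "s \<in> S" for s
    using hom_coords_proj_point[OF x[OF that]] that by (metis restrict_apply)
  then obtain l where "\<And>s. s \<in> S \<Longrightarrow> l s \<noteq> 0"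
    "\<And>s. s \<in> S \<Longrightarrow> (hom_coords \<circ> ?v) s = l s *s x s"
    unfolding o_def by metis
  then obtain c where "c \<noteq> 0" "G (hom_coords \<circ> ?v) = c *s G x"
    using multihom_tuple_scale[OF G] by blast
  then show ?thesis
    by (simp add: tuple_map_def proj_point_scale)
qed

lemma multihomogeneous_add:
  assumes "multihomogeneous S d F" "multihomogeneous S d G"
  shows "multihomogeneous S d (\<lambda>x. F x + G x)"
proof -
  obtain E1 c1 where 1: "finite E1" "\<forall>e\<in>E1. \<forall>s\<in>S. (\<Sum>j\<in>UNIV. e s j) = d s"
    "F = (\<lambda>x. \<Sum>e\<in>E1. c1 e * (\<Prod>s\<in>S. \<Prod>j\<in>UNIV. (x s $ j) ^ e s j))"
    using assms(1) unfolding multihomogeneous_def by blast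
  obtain E2 c2 where 2: "finite E2" "\<forall>e\<in>E2. \<forall>s\<in>S. (\<Sum>j\<in>UNIV. e s j) = d s"
    "G = (\<lambda>x. \<Sum>e\<in>E2. c2 e * (\<Prod>s\<in>S. \<Prod>j\<in>UNIV. (x s $ j) ^ e s j))"
    using assms(2) unfolding multihomogeneous_def by blast
  let ?m = "\<lambda>x e. \<Prod>s\<in>S. \<Prod>j\<in>UNIV. (x s $ j) ^ e s j"
  let ?c = "\<lambda>e. (if e \<in> E1 then c1 e else 0) + (if e \<in> E2 then c2 e else 0)"
  have "F x + G x = (\<Sum>e\<in>E1 \<union> E2. ?c e * ?m x e)" for x
  proof -
    have "F x = (\<Sum>e\<in>E1 \<union> E2. (if e \<in> E1 then c1 e else 0) * ?m x e)"
      unfolding 1(3) by (rule sum.mono_neutral_cong_left) (use 1 2 in auto)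
    moreover have "G x = (\<Sum>e\<in>E1 \<union> E2. (if e \<in> E2 then c2 e else 0) * ?m x e)"
      unfolding 2(3) by (rule sum.mono_neutral_cong_left) (use 1 2 in auto)
    ultimately show ?thesis
      by (simp add: distrib_right sum.distrib)
  qed
  then show ?thesis
    unfolding multihomogeneous_def
    by (intro exI[of _ "E1 \<union> E2"] exI[of _ ?c]) (use 1(1,2) 2(1,2) in auto)
qed

lemma multihomogeneous_scalar:
  assumes "multihomogeneous S d F"
  shows "multihomogeneous S d (\<lambda>x. k * F x)"
proof -
  obtain E c where 1: "finite E" "\<forall>e\<in>E. \<forall>s\<in>S. (\<Sum>j\<in>UNIV. e s j) = d s"
    "F = (\<lambda>x. \<Sum>e\<in>E. c e * (\<Prod>s\<in>S. \<Prod>j\<in>UNIV. (x s $ j) ^ e s j))"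
    using assms(1) unfolding multihomogeneous_def by blast
  then show ?thesis
    unfolding multihomogeneous_def
    by (intro exI[of _ E] exI[of _ "\<lambda>e. k * c e"]) (auto simp: sum_distrib_left mult.assoc)
qed

lemma multihomogeneous_diff:
  assumes "multihomogeneous S d F" "multihomogeneous S d G"
  shows "multihomogeneous S d (\<lambda>x. F x - G x)"
  using multihomogeneous_add[OF assms(1) multihomogeneous_scalar[OF assms(2), of "- 1"]] by simp

lemma multihomogeneous_multilinear:
  assumes "finite S" "A \<subseteq> S"
  shows "multihomogeneous S (\<lambda>s. if s \<in> A then 1 else 0) (\<lambda>x. \<Prod>s\<in>A. x s $ f s)"
proof -
  let ?e = "\<lambda>s j. if s \<in> A \<and> j = f s then 1 else (0::nat)"
  have "(\<Prod>s\<in>A. x s $ f s) = (\<Prod>s\<in>S. \<Prod>j\<in>UNIV. (x s $ j) ^ ?e s j)"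
    for x :: "int \<Rightarrow> 'a ^ 'b"
  proof (rule prod.mono_neutral_cong_left)
    fix s assume "s \<in> A"
    then have "(\<Prod>j\<in>UNIV. (x s $ j) ^ ?e s j) = (\<Prod>j\<in>UNIV. if j = f s then x s $ j else 1)"
      by (intro prod.cong) auto
    then show "x s $ f s = (\<Prod>j\<in>UNIV. (x s $ j) ^ ?e s j)"
      by (simp add: prod.delta)
  qed (use assms in auto)
  then show ?thesis
    unfolding multihomogeneous_def
    by (intro exI[of _ "{?e}"] exI[of _ "\<lambda>_. 1"]) (auto simp: sum.delta)
qed


section \<open>Rational maps with a generic formula\<close>

text \<open>
  The partial map \<open>g\<close> is given by \<open>F\<close> on a nonempty Zariski open set, the nonvanishing locus of
  \<open>D\<close>. This is the hypothesis under which \<open>rational_extension S g\<close> is well behaved.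
\<close>

definition generic_formula ::
  "int set \<Rightarrow> ((int \<Rightarrow> ('a::field, 'n::finite) proj_space) \<rightharpoonup> ('a, 'n) proj_space) \<Rightarrow>
    ((int \<Rightarrow> 'a ^ 'n) \<Rightarrow> 'a ^ 'n) \<Rightarrow> bool" where
  "generic_formula S g F \<longleftrightarrow> (\<exists>D. line_poly D \<and> (\<exists>x. D x \<noteq> 0) \<and>
     (\<forall>x. D x \<noteq> 0 \<longrightarrow> (\<forall>s\<in>S. x s \<noteq> 0) \<and> F x \<noteq> 0 \<and>
        g (\<lambda>s\<in>S. proj_point (x s)) = Some (proj_point (F x))))"

lemma line_poly_represents: "represents S G g \<Longrightarrow> line_poly (\<lambda>x. G x $ j)"
  unfolding represents_def
  by (rule line_poly_multihom_tuple[where S = S and Y = "\<lambda>x. x"]) (auto intro: line_poly_coord)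

lemma represents_parallel_generic:
  assumes G: "represents S G g" and S: "finite S"
    and x: "\<And>s. s \<in> S \<Longrightarrow> x s \<noteq> 0" and gx: "g (\<lambda>s\<in>S. proj_point (x s)) = Some (proj_point y)"
    and y: "y \<noteq> 0"
  shows "parallel (G x) y"
proof (cases "G x = 0")
  case False
  have "multihom_tuple S G" using G by (simp add: represents_def)
  from tuple_map_proj_point[OF this S x] False
  have t: "tuple_map S G (\<lambda>s\<in>S. proj_point (x s)) = Some (proj_point (G x))"
    by simp
  then have "proj_point (G x) = proj_point y"
    using G gx unfolding represents_def by (metis IntI domI option.inject)
  then show ?thesis using False y by (simp add: proj_point_eq_iff)
qed simp

text \<open>
  A representing tuple agrees with the generic formula on the open set, so the minors of \<open>G\<close>
  against any polynomial tuple \<open>H\<close> that also agrees there vanish on the open set, hence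
  everywhere.
\<close>

lemma represents_parallel:
  fixes g :: "(int \<Rightarrow> ('a::alg_closed_field, 'n::finite) proj_space) \<rightharpoonup> ('a, 'n) proj_space"
  assumes g: "generic_formula S g F" and S: "finite S"
    and G: "represents S G g" and H: "\<And>j. line_poly (\<lambda>x. H x $ j)"
    and HF: "\<And>x. g (\<lambda>s\<in>S. proj_point (x s)) = Some (proj_point (F x)) \<Longrightarrow>
      \<forall>s\<in>S. x s \<noteq> 0 \<Longrightarrow> F x \<noteq> 0 \<Longrightarrow> parallel (H x) (F x)"
  shows "parallel (G x) (H x)"
  unfolding parallel_def
proof (intro allI)
  fix j k
  obtain D where D: "line_poly D" "\<exists>x. D x \<noteq> 0" and DD: "\<And>x. D x \<noteq> 0 \<Longrightarrow> (\<forall>s\<in>S. x s \<noteq> 0) \<and> F x \<noteq> 0 \<and>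
        g (\<lambda>s\<in>S. proj_point (x s)) = Some (proj_point (F x))"
    using g unfolding generic_formula_def by blast
  have "G x $ j * H x $ k - G x $ k * H x $ j = 0"
  proof (rule line_poly_vanishes[where I = "{()}" and F = "\<lambda>_. D"
        and E = "\<lambda>x. G x $ j * H x $ k - G x $ k * H x $ j"])
    show "line_poly (\<lambda>x. G x $ j * H x $ k - G x $ k * H x $ j)"
      by (intro line_poly_diff line_poly_mult line_poly_represents[OF G] H)
    fix x assume "\<And>i. i \<in> {()} \<Longrightarrow> D x \<noteq> 0"
    then have d: "\<forall>s\<in>S. x s \<noteq> 0" "F x \<noteq> 0"
       "g (\<lambda>s\<in>S. proj_point (x s)) = Some (proj_point (F x))"
      using DD by blast+
    have "parallel (G x) (F x)"
      using represents_parallel_generic[OF G S _ d(3)] d by blast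
    moreover have "parallel (F x) (H x)" using HF d parallel_commute by blast
    ultimately have "parallel (G x) (H x)" using d(2) parallel_trans by blast
    then show "G x $ j * H x $ k - G x $ k * H x $ j = 0"
      by (simp add: parallel_def)
  qed (use D in auto)
  then show "G x $ j * H x $ k = G x $ k * H x $ j" by simp
qed

text \<open>
  A tuple map is defined only on the product indexed by \<open>S\<close>, so what \<open>g\<close> does elsewhere has no
  influence on the tuples that represent it.
\<close>

lemma rational_extension_cong:
  assumes "\<And>v. v \<in> S \<rightarrow>\<^sub>E UNIV \<Longrightarrow> g v = g' v"
  shows "rational_extension S g = rational_extension S g'"
proof -
  have "represents S G g \<longleftrightarrow> represents S G g'" for G
  proof -
    have "v \<in> S \<rightarrow>\<^sub>E UNIV" if "v \<in> dom (tuple_map S G)" for v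
      using that by (auto simp: tuple_map_def split: if_splits)
    then show ?thesis
      unfolding represents_def dom_def Ball_def using assms by auto
  qed
  then show ?thesis
    by (simp add: rational_extension_def fun_eq_iff)
qed

text \<open>
  All representing tuples are parallel to each other at every point, so the description operator in
  the definition of \<open>rational_extension\<close> picks the value of any of them that does not vanish.
\<close>

lemma rational_extension_eq_Some_iff:
  fixes g :: "(int \<Rightarrow> ('a::alg_closed_field, 'n::finite) proj_space) \<rightharpoonup> ('a, 'n) proj_space"
  assumes g: "generic_formula S g F" and S: "finite S"
  shows "rational_extension S g v = Some p \<longleftrightarrow> (\<exists>G. represents S G g \<and> tuple_map S G v = Some p)"
proof -
  have uniq: "p = q" if G: "represents S G g" "tuple_map S G v = Some p"
    and H: "represents S H g" "tuple_map S H v = Some q" for G H p q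
  proof -
    have "parallel (G (hom_coords \<circ> v)) (H (hom_coords \<circ> v))"
      by (rule represents_parallel[OF g S G(1) line_poly_represents[OF H(1)]])
        (use represents_parallel_generic[OF H(1) S] in blast)
    moreover have "G (hom_coords \<circ> v) \<noteq> 0" "proj_point (G (hom_coords \<circ> v)) = p"
      "H (hom_coords \<circ> v) \<noteq> 0" "proj_point (H (hom_coords \<circ> v)) = q"
      using G H by (auto simp: tuple_map_def split: if_splits)
    ultimately show "p = q" using proj_point_eq_iff by metis
  qed
  show ?thesis
  proof
    assume *: "rational_extension S g v = Some p"
    then have "\<exists>G. represents S G g \<and> v \<in> dom (tuple_map S G)"
      unfolding rational_extension_def by (metis option.distinct(1))
    then obtain G q where G: "represents S G g" "tuple_map S G v = Some q"
      by blast
    then have "(THE p. \<exists>G. represents S G g \<and> tuple_map S G v = Some p) = q"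
      using uniq by (intro the_equality) blast+
    then have "q = p"
      using * G unfolding rational_extension_def by (auto split: if_splits)
    then show "\<exists>G. represents S G g \<and> tuple_map S G v = Some p" using G by blast
  next
    assume **: "\<exists>G. represents S G g \<and> tuple_map S G v = Some p"
    then have "(THE p. \<exists>G. represents S G g \<and> tuple_map S G v = Some p) = p"
      using uniq by (intro the_equality) blast+
    then show "rational_extension S g v = Some p"
      using ** unfolding rational_extension_def by auto
  qed
qed


section \<open>Points and lines of the plane\<close>

text \<open>
  In the plane, \<open>cross\<close> gives the coordinates of the line through two points and, dually, of the
  common point of two lines; \<open>dot\<close> decides incidence.
\<close>

definition cross :: "('a::field) ^ 3 \<Rightarrow> 'a ^ 3 \<Rightarrow> 'a ^ 3" where
  "cross x y = vector [x $ 2 * y $ 3 - x $ 3 * y $ 2,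
     x $ 3 * y $ 1 - x $ 1 * y $ 3, x $ 1 * y $ 2 - x $ 2 * y $ 1]"

definition dot :: "('a::field) ^ 3 \<Rightarrow> 'a ^ 3 \<Rightarrow> 'a" where
  "dot x y = x $ 1 * y $ 1 + x $ 2 * y $ 2 + x $ 3 * y $ 3"

lemma cross_nth [simp]:
  "cross x y $ 1 = x $ 2 * y $ 3 - x $ 3 * y $ 2"
  "cross x y $ 2 = x $ 3 * y $ 1 - x $ 1 * y $ 3"
  "cross x y $ 3 = x $ 1 * y $ 2 - x $ 2 * y $ 1"
  by (simp_all add: cross_def)

lemma cross_0 [simp]: "cross 0 x = 0" "cross x 0 = 0"
  by (simp_all add: vec_eq_iff forall_3)

lemma cross_scale: "cross (k *s x) (l *s y) = (k * l) *s cross x y"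
  by (simp add: vec_eq_iff forall_3 algebra_simps)

lemma cross_eq_0_iff: "cross x y = 0 \<longleftrightarrow> parallel x y"
  by (auto simp: vec_eq_iff forall_3 parallel_def algebra_simps)

text \<open>
  Two lines through \<open>w\<close> meet in \<open>w\<close>; the factor is the determinant of the three vectors, which
  vanishes exactly if the two lines coincide or one of them degenerates. The whole computation of
  the composite consists of applications of this identity.
\<close>

lemma cross_cross_common:
  "cross (cross u w) (cross w v) = dot (cross u w) v *s w"
  by (simp add: vec_eq_iff forall_3 dot_def algebra_simps)

lemma dot_scale: "dot (c *s u) v = c * dot u v" "dot u (c *s v) = c * dot u v"
  by (simp_all add: dot_def algebra_simps)

lemma mem_span_pair_iff:
  assumes "cross x y \<noteq> 0"
  shows "u \<in> vec.span {x, y} \<longleftrightarrow> dot (cross x y) u = 0"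
proof
  assume "u \<in> vec.span {x, y}"
  then obtain k l where "u - k *s x = l *s y"
    by (auto simp: vec.span_insert)
  then have u: "u = k *s x + l *s y"
    by (metis diff_add_cancel add.commute)
  show "dot (cross x y) u = 0"
    unfolding u by (simp add: dot_def algebra_simps)
next
  assume dot: "dot (cross x y) u = 0"
  obtain k where k: "cross x y $ k \<noteq> 0"
    using assms by (auto simp: vec_eq_iff)
  \<comment> \<open>Cramer's rule for \<open>u\<close> in the basis \<open>x\<close>, \<open>y\<close> of the plane orthogonal to \<open>cross x y\<close>.\<close>
  have "\<forall>k j. cross x y $ k * u $ j - cross u y $ k * x $ j - cross x u $ k * y $ j =
      (if j = k then dot (cross x y) u else 0)"
    by (simp add: forall_3 dot_def algebra_simps)
  then have "\<forall>j. cross x y $ k * u $ j = cross u y $ k * x $ j + cross x u $ k * y $ j"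
    using dot by (simp add: algebra_simps)
  then have "u = (cross u y $ k / cross x y $ k) *s x + (cross x u $ k / cross x y $ k) *s y"
    using k by (simp add: vec_eq_iff field_simps)
  also have "\<dots> \<in> vec.span {x, y}"
    by (intro vec.span_add vec.span_scale vec.span_base) auto
  finally show "u \<in> vec.span {x, y}" .
qed

lemma mem_proj_line_iff:
  assumes "cross x y \<noteq> 0" "u \<noteq> 0"
  shows "proj_point u \<in> proj_line (proj_point x) (proj_point y) \<longleftrightarrow> dot (cross x y) u = 0"
proof -
  have "x \<noteq> 0" "y \<noteq> 0" using assms(1) by auto
  have "vec.span (vec.span {x} \<union> vec.span {y}) = vec.span {x, y}"
    by (simp only: vec.span_Un vec.span_span insert_is_Un[of x "{y}"])
  moreover have "vec.span {u} \<subseteq> vec.span {x, y} \<longleftrightarrow> u \<in> vec.span {x, y}"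
    using vec.span_base[of u "{u}"] vec.span_minimal[of "{u}" "vec.span {x, y}"]
      vec.subspace_span by blast
  ultimately show ?thesis
    using assms \<open>x \<noteq> 0\<close> \<open>y \<noteq> 0\<close>
    by (simp add: proj_line_def Rep_proj_point mem_span_pair_iff)
qed

text \<open>
  The 2 by 2 minors of \<open>u\<close> and \<open>cross l m\<close> are, up to sign, combinations of \<open>dot l u\<close> and
  \<open>dot m u\<close>.
\<close>

lemma parallel_cross_if_orthogonal:
  assumes "dot l u = 0" "dot m u = 0"
  shows "parallel u (cross l m)"
proof -
  have "u $ 1 * cross l m $ 2 - u $ 2 * cross l m $ 1 = l $ 3 * dot m u - m $ 3 * dot l u"
    "u $ 2 * cross l m $ 3 - u $ 3 * cross l m $ 2 = l $ 1 * dot m u - m $ 1 * dot l u"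
    "u $ 3 * cross l m $ 1 - u $ 1 * cross l m $ 3 = l $ 2 * dot m u - m $ 2 * dot l u"
    by (simp_all add: dot_def algebra_simps)
  then show ?thesis
    using assms by (simp add: parallel_def forall_3 del: cross_nth)
qed

text \<open>
  The iterated cross product vanishes exactly in the cases in which \<open>line_meet\<close> is undefined: the
  points that should span a line coincide, or the two lines are the same line, which then contains
  two distinct points.
\<close>

lemma line_meet_proj_point:
  assumes nz: "x \<noteq> 0" "y \<noteq> 0" "z \<noteq> 0" "w \<noteq> 0"
  shows "line_meet (proj_point x) (proj_point y) (proj_point z) (proj_point w) =
    (if cross (cross x y) (cross z w) \<noteq> 0
     then Some (proj_point (cross (cross x y) (cross z w))) else None)"
proof (cases "cross x y = 0 \<or> cross z w = 0")
  case True
  then have "proj_point x = proj_point y \<or> proj_point z = proj_point w"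
    using nz by (simp add: proj_point_eq_iff cross_eq_0_iff)
  then show ?thesis using True by (auto simp: line_meet_def)
next
  case False
  then have l: "cross x y \<noteq> 0" and m: "cross z w \<noteq> 0" by auto
  then have ne: "proj_point x \<noteq> proj_point y" "proj_point z \<noteq> proj_point w"
    using nz by (simp_all add: proj_point_eq_iff cross_eq_0_iff)
  let ?I = "proj_line (proj_point x) (proj_point y) \<inter> proj_line (proj_point z) (proj_point w)"
  show ?thesis
  proof (cases "cross (cross x y) (cross z w) = 0")
    case False
    let ?u = "cross (cross x y) (cross z w)"
    have "dot (cross x y) ?u = 0" "dot (cross z w) ?u = 0"
      by (simp_all add: dot_def algebra_simps)
    then have "proj_point ?u \<in> ?I"
      using mem_proj_line_iff[OF l False] mem_proj_line_iff[OF m False] by blast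
    moreover have "p = proj_point ?u" if p: "p \<in> ?I" for p
    proof -
      have "proj_point (hom_coords p) \<in> ?I" using p by simp
      then have "parallel (hom_coords p) ?u"
        using mem_proj_line_iff[OF l hom_coords_nonzero] mem_proj_line_iff[OF m hom_coords_nonzero]
        by (blast intro: parallel_cross_if_orthogonal)
      then have "proj_point (hom_coords p) = proj_point ?u"
        using False by (subst proj_point_eq_iff) simp_all
      then show ?thesis by simp
    qed
    ultimately have "?I = {proj_point ?u}" by blast
    then show ?thesis using False ne by (simp add: line_meet_def)
  next
    case True
    then have "parallel (cross z w) (cross x y)"
      by (simp only: cross_eq_0_iff parallel_commute)
    then obtain c where c: "cross z w = c *s cross x y"
      using l parallel_imp_scale by blast
    then have "c \<noteq> 0" using m by auto
    then have "dot (cross z w) u = 0 \<longleftrightarrow> dot (cross x y) u = 0" for u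
      unfolding c by (simp add: dot_scale \<open>c \<noteq> 0\<close>)
    moreover have "dot (cross x y) x = 0" "dot (cross x y) y = 0"
      by (simp_all add: dot_def algebra_simps)
    ultimately have "proj_point x \<in> ?I" "proj_point y \<in> ?I"
      using mem_proj_line_iff[OF l] mem_proj_line_iff[OF m] nz by blast+
    then have "\<not> is_singleton ?I"
      using ne(1) by (metis is_singletonE singletonD)
    then show ?thesis using True by (simp add: line_meet_def)
  qed
qed


section \<open>The tuple of a skew pentagram map\<close>

definition meet_tuple :: "int \<Rightarrow> int \<Rightarrow> int \<Rightarrow> int \<Rightarrow> (int \<Rightarrow> ('a::field) ^ 3) \<Rightarrow> 'a ^ 3" where
  "meet_tuple a b c d x = cross (cross (x a) (x b)) (cross (x c) (x d))"

lemma meet_tuple_nonzero: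
  assumes "meet_tuple a b c d x \<noteq> 0" "s \<in> {a, b, c, d}"
  shows "x s \<noteq> 0"
  using assms by (auto simp: meet_tuple_def)

text \<open>
  Each component is a difference of products of two minors, one in the coordinates at \<open>a\<close> and
  \<open>b\<close> and one in those at \<open>c\<close> and \<open>d\<close>. Expanded, it is multilinear in the four points, which
  makes sense as multidegree 1 at each index because the indices are distinct.
\<close>

lemma multihom_meet_tuple:
  assumes "distinct [a, b, c, d]"
  shows "multihom_tuple {a, b, c, d} (meet_tuple a b c d :: (int \<Rightarrow> ('a::field) ^ 3) \<Rightarrow> 'a ^ 3)"
proof -
  let ?S = "{a, b, c, d}"
  let ?d = "\<lambda>s. if s \<in> ?S then 1 else (0::nat)"
  have mono: "multihomogeneous ?S ?d
      (\<lambda>x :: int \<Rightarrow> 'a ^ 3. x a $ i * x b $ j * (x c $ k * x d $ l))" for i j k l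
    using multihomogeneous_multilinear[of ?S ?S
        "\<lambda>s. if s = a then i else if s = b then j else if s = c then k else l"] assms
    by (simp add: mult.assoc)
  have minors: "multihomogeneous ?S ?d (\<lambda>x :: int \<Rightarrow> 'a ^ 3.
      (x a $ i * x b $ j - x a $ j * x b $ i) * (x c $ k * x d $ l - x c $ l * x d $ k))" for i j k l
    unfolding left_diff_distrib right_diff_distrib
    by (intro multihomogeneous_diff mono)
  have "\<forall>j. multihomogeneous ?S ?d (\<lambda>x :: int \<Rightarrow> 'a ^ 3. meet_tuple a b c d x $ j)"
    unfolding forall_3 meet_tuple_def cross_nth
    by (intro conjI multihomogeneous_diff minors)
  then show ?thesis unfolding multihom_tuple_def by blast
qed

lemma line_poly_meet_tuple:
  assumes "\<And>s j. line_poly (\<lambda>x. Y x s $ j)"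
  shows "line_poly (\<lambda>x. meet_tuple a b c d (Y x) $ j)"
proof -
  have "\<forall>j. line_poly (\<lambda>x. meet_tuple a b c d (Y x) $ j)"
    unfolding forall_3 meet_tuple_def cross_nth
    by (intro conjI line_poly_diff line_poly_mult assms)
  then show ?thesis by blast
qed

lemma tuple_map_meet_tuple:
  assumes "v \<in> {a, b, c, d} \<rightarrow>\<^sub>E UNIV"
  shows "tuple_map {a, b, c, d} (meet_tuple a b c d) v = line_meet (v a) (v b) (v c) (v d)"
  using line_meet_proj_point[of "hom_coords (v a)" "hom_coords (v b)" "hom_coords (v c)"
      "hom_coords (v d)"] assms
  by (simp add: tuple_map_def meet_tuple_def)

lemma generic_formula_line_meet:
  assumes "distinct [a, b, c, d]"
  shows "generic_formula {a, b, c, d}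
    (\<lambda>v. line_meet (v a) (v b) (v c) (v d :: ('k::field, 3) proj_space)) (meet_tuple a b c d)"
proof -
  \<comment> \<open>The lines joining \<open>e1\<close> to \<open>e2\<close> and \<open>e1\<close> to \<open>e3\<close> meet in \<open>e1\<close>.\<close>
  let ?x = "\<lambda>s. if s = b then axis 2 1 else if s = d then axis 3 1 else axis 1 1 :: 'k ^ 3"
  have "meet_tuple a b c d ?x $ 1 \<noteq> 0"
    using assms by (simp add: meet_tuple_def axis_def)
  moreover have "line_poly (\<lambda>x. meet_tuple a b c d x $ 1 :: 'k)"
    by (intro line_poly_meet_tuple line_poly_coord)
  moreover have "(\<forall>s\<in>{a, b, c, d}. x s \<noteq> 0) \<and> meet_tuple a b c d x \<noteq> 0 \<and>
      line_meet (proj_point (x a)) (proj_point (x b)) (proj_point (x c)) (proj_point (x d)) =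
      Some (proj_point (meet_tuple a b c d x))" if "meet_tuple a b c d x $ 1 \<noteq> 0"
    for x :: "int \<Rightarrow> 'k ^ 3"
  proof -
    have nz: "meet_tuple a b c d x \<noteq> 0"
      using that by auto
    moreover from nz have "\<forall>s\<in>{a, b, c, d}. x s \<noteq> 0"
      using meet_tuple_nonzero by blast
    ultimately show ?thesis
      by (simp add: line_meet_proj_point meet_tuple_def)
  qed
  ultimately show ?thesis
    unfolding generic_formula_def by (intro exI[of _ "\<lambda>x. meet_tuple a b c d x $ 1"]) auto
qed

lemma represents_meet_tuple:
  assumes "distinct [a, b, c, d]"
  shows "represents {a, b, c, d} (meet_tuple a b c d) (\<lambda>v. line_meet (v a) (v b) (v c) (v d))"
  unfolding represents_def
proof (intro conjI ballI multihom_meet_tuple assms)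
  fix v assume "v \<in> dom (tuple_map {a, b, c, d} (meet_tuple a b c d)) \<inter>
    dom (\<lambda>v. line_meet (v a) (v b) (v c) (v d))"
  then have "v \<in> {a, b, c, d} \<rightarrow>\<^sub>E UNIV"
    by (auto simp: tuple_map_def split: if_splits)
  then show "tuple_map {a, b, c, d} (meet_tuple a b c d) v = line_meet (v a) (v b) (v c) (v d)"
    by (rule tuple_map_meet_tuple)
qed

text \<open>
  This ties an arbitrary representative, about which nothing else is known, to the explicit formula.
  It carries information only where \<open>meet_tuple\<close> does not vanish, that is, at generic points.
\<close>

lemma represents_line_meet_parallel:
  fixes G :: "(int \<Rightarrow> ('k::alg_closed_field) ^ 3) \<Rightarrow> 'k ^ 3"
  assumes "distinct [a, b, c, d]"
    and "represents {a, b, c, d} G (\<lambda>v. line_meet (v a) (v b) (v c) (v d))"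
  shows "parallel (G x) (meet_tuple a b c d x)"
  by (rule represents_parallel[OF generic_formula_line_meet[OF assms(1)] _ assms(2)])
    (auto intro!: line_poly_meet_tuple line_poly_coord simp: parallel_def mult.commute)

lemma skew_pentagram_eq_Some_iff:
  assumes "distinct [a, b, c, d]"
  shows "snd (skew_pentagram a b c d) v = Some (p :: ('k::alg_closed_field, 3) proj_space) \<longleftrightarrow>
    (\<exists>G. represents {a, b, c, d} G (\<lambda>v. line_meet (v a) (v b) (v c) (v d)) \<and>
      tuple_map {a, b, c, d} G v = Some p)"
  unfolding skew_pentagram_def snd_conv
  by (rule rational_extension_eq_Some_iff[OF generic_formula_line_meet[OF assms]]) simp

lemma skew_pentagram_proj_point:
  fixes x :: "int \<Rightarrow> ('k::alg_closed_field) ^ 3"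
  assumes "distinct [a, b, c, d]" "meet_tuple a b c d x \<noteq> 0"
  shows "snd (skew_pentagram a b c d) (\<lambda>s\<in>{a, b, c, d}. proj_point (x s)) =
    Some (proj_point (meet_tuple a b c d x))"
  unfolding skew_pentagram_eq_Some_iff[OF assms(1)]
  using represents_meet_tuple[OF assms(1)] assms(2)
    tuple_map_proj_point[OF multihom_meet_tuple[OF assms(1)], of x] meet_tuple_nonzero[OF assms(2)]
  by (intro exI[of _ "meet_tuple a b c d"]) simp

lemma local_rule_skew_pentagram:
  assumes "distinct [a, b, c, d]"
  shows "local_rule (skew_pentagram a b c d :: ('k::field, 3) local_rule)"
proof -
  let ?S = "{a, b, c, d}" and ?C = "meet_tuple a b c d :: (int \<Rightarrow> 'k ^ 3) \<Rightarrow> 'k ^ 3"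
  obtain x where x: "\<forall>s\<in>?S. x s \<noteq> 0" "?C x \<noteq> 0"
    using generic_formula_line_meet[OF assms] unfolding generic_formula_def by metis
  then have "(\<lambda>s\<in>?S. proj_point (x s)) \<in> dom (tuple_map ?S ?C)"
    using tuple_map_proj_point[OF multihom_meet_tuple[OF assms], of x] by auto
  then have "rational_map ?S (rational_extension ?S (tuple_map ?S ?C))"
    using multihom_meet_tuple[OF assms] unfolding rational_map_def by blast
  also have "rational_extension ?S (tuple_map ?S ?C) =
      rational_extension ?S (\<lambda>v. line_meet (v a) (v b) (v c) (v d))"
    by (rule rational_extension_cong) (rule tuple_map_meet_tuple)
  finally show ?thesis
    by (simp add: local_rule_def skew_pentagram_def)
qed


section \<open>The composite of the two tuples\<close>

text \<open>
  Homogeneous coordinates for the image of the configuration \<open>x\<close> under the lattice map.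
\<close>

definition regional_tuple ::
  "int \<Rightarrow> int \<Rightarrow> int \<Rightarrow> int \<Rightarrow> (int \<Rightarrow> ('a::field) ^ 3) \<Rightarrow> int \<Rightarrow> 'a ^ 3" where
  "regional_tuple a b c d x i = meet_tuple a b c d (\<lambda>s. x (i + s))"

text \<open>
  This is zero iff the three lines through the pairs of points are concurrent or one of the pairs does
  not span a line.
\<close>

definition lines_det :: "(int \<Rightarrow> ('a::field) ^ 3) \<Rightarrow> int \<Rightarrow> int \<Rightarrow> int \<Rightarrow> int \<Rightarrow> int \<Rightarrow> int \<Rightarrow> 'a" where
  "lines_det x i j k l m n =
     dot (cross (cross (x i) (x j)) (cross (x k) (x l))) (cross (x m) (x n))"

lemma line_poly_dot_cross:
  assumes "\<And>j. line_poly (\<lambda>x. U x $ j)" "\<And>j. line_poly (\<lambda>x. V x $ j)"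
    "\<And>j. line_poly (\<lambda>x. W x $ j)"
  shows "line_poly (\<lambda>x. dot (cross (U x) (V x)) (W x))"
  unfolding dot_def cross_nth
  by (intro line_poly_add line_poly_diff line_poly_mult assms)

lemma line_poly_cross:
  assumes "\<And>j. line_poly (\<lambda>x. U x $ j)" "\<And>j. line_poly (\<lambda>x. V x $ j)"
  shows "line_poly (\<lambda>x. cross (U x) (V x) $ j)"
proof -
  have "\<forall>j. line_poly (\<lambda>x. cross (U x) (V x) $ j)"
    unfolding forall_3 cross_nth
    by (intro conjI line_poly_diff line_poly_mult assms)
  then show ?thesis by blast
qed

lemma line_poly_lines_det: "line_poly (\<lambda>x. lines_det x i j k l m n)"
  unfolding lines_det_def
  by (intro line_poly_dot_cross line_poly_cross line_poly_coord)

text \<open>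
  The six indices that occur are pairwise distinct except that \<open>- m - n = n\<close> if \<open>m = - 2 * n\<close> and
  \<open>n - m = - n\<close> if \<open>m = 2 * n\<close>. Each pair shares at most this one point with another, so the pairs
  can be sent to the three sides of the coordinate triangle; the two cases of the proof place the
  shared vertex so that it is compatible with one coincidence each.
\<close>

lemma ex_lines_det_nonzero:
  fixes m n :: int
  assumes "m \<noteq> 0" "n \<noteq> 0" "m \<noteq> n" "m \<noteq> - n"
  shows "\<exists>x :: int \<Rightarrow> ('a::field) ^ 3. lines_det x (- m - n) (- n) (- m) 0 (n - m) n \<noteq> 0"
proof (cases "m = - 2 * n")
  case False
  let ?x = "\<lambda>i. if i = - m - n \<or> i = - m then axis 1 1
    else if i = - n \<or> i = n - m then axis 2 1 else axis 3 1 :: 'a ^ 3"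
  have "?x (- m - n) = axis 1 1" "?x (- n) = axis 2 1" "?x (- m) = axis 1 1" "?x 0 = axis 3 1"
    "?x (n - m) = axis 2 1" "?x n = axis 3 1"
    using assms False by auto
  then have "lines_det ?x (- m - n) (- n) (- m) 0 (n - m) n \<noteq> 0"
    unfolding lines_det_def by (simp only:) (simp add: dot_def axis_def)
  then show ?thesis by blast
next
  case True
  let ?x = "\<lambda>i. if i = - m - n \<or> i = n then axis 2 1
    else if i = - n \<or> i = - m then axis 1 1 else axis 3 1 :: 'a ^ 3"
  have "?x (- m - n) = axis 2 1" "?x (- n) = axis 1 1" "?x (- m) = axis 1 1" "?x 0 = axis 3 1"
    "?x (n - m) = axis 3 1" "?x n = axis 2 1"
    using assms True by auto
  then have "lines_det ?x (- m - n) (- n) (- m) 0 (n - m) n \<noteq> 0"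
    unfolding lines_det_def by (simp only:) (simp add: dot_def axis_def)
  then show ?thesis by blast
qed

text \<open>
  The heart of the matter. Since \<open>a - b = c - d\<close>, the image points with indices \<open>- d\<close> and \<open>- b\<close>
  both lie on the line through \<open>x (c - d)\<close> and \<open>x 0\<close>, and those with indices \<open>- c\<close> and \<open>- a\<close> both lie
  on the line through \<open>x 0\<close> and \<open>x (d - c)\<close>. The second map intersects these two lines and so
  recovers \<open>x 0\<close>. The three determinants measure that the image points span the two lines and
  that the lines differ.
\<close>

lemma meet_tuple_regional_tuple:
  assumes "b - a = d - c"
  shows "meet_tuple (- d) (- b) (- c) (- a) (regional_tuple a b c d x) =
    (lines_det x (a - d) (b - d) (c - d) 0 (c - b) (d - b) *
     lines_det x (a - c) (b - c) 0 (d - c) (c - a) (d - a) *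
     dot (cross (x (c - d)) (x 0)) (x (d - c))) *s x 0"
proof -
  have e: "a - b = c - d" "b - a = d - c" using assms by auto
  show ?thesis
    unfolding meet_tuple_def regional_tuple_def lines_det_def
    by (simp add: e cross_cross_common cross_scale)
qed

text \<open>
  By the integral domain property it is enough to find a nonzero of each of the three determinants
  separately.
\<close>

lemma ex_meet_tuple_regional_tuple_nonzero:
  fixes a b c d :: int
  assumes dist: "distinct [a, b, c, d]" and eq: "b - a = d - c"
  shows "\<exists>x :: int \<Rightarrow> ('k::alg_closed_field) ^ 3.
    meet_tuple (- d) (- b) (- c) (- a) (regional_tuple a b c d x) \<noteq> 0"
proof -
  let ?D1 = "\<lambda>x :: int \<Rightarrow> 'k ^ 3. lines_det x (a - d) (b - d) (c - d) 0 (c - b) (d - b)"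
  let ?D2 = "\<lambda>x :: int \<Rightarrow> 'k ^ 3. lines_det x (a - c) (b - c) 0 (d - c) (c - a) (d - a)"
  let ?D3 = "\<lambda>x :: int \<Rightarrow> 'k ^ 3. dot (cross (x (c - d)) (x 0)) (x (d - c))"
  \<comment> \<open>In these terms the relevant indices are sums of multiples of \<open>m\<close> and \<open>n\<close>.\<close>
  define m n where "m = b - a" and "n = c - a"
  have b: "b = a + m" and c: "c = a + n" and d: "d = a + m + n"
    using eq by (auto simp: m_def n_def)
  have mn: "m \<noteq> 0" "n \<noteq> 0" "m \<noteq> n" "m \<noteq> - n"
    using dist by (auto simp: b c d)
  obtain x1 where "?D1 x1 \<noteq> 0"
    using ex_lines_det_nonzero[OF mn] by (auto simp: b c d)
  moreover obtain x2 where "?D2 x2 \<noteq> 0"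
  proof -
    \<comment> \<open>The second determinant is, up to sign, the first one with \<open>m\<close> replaced by \<open>- m\<close>.\<close>
    obtain x :: "int \<Rightarrow> 'k ^ 3" where "lines_det x (m - n) (- n) m 0 (n + m) n \<noteq> 0"
      using ex_lines_det_nonzero[of "- m" n] mn by auto
    moreover have "lines_det x (m - n) (- n) m 0 (n + m) n = - lines_det x (- n) (m - n) 0 m n (n + m)"
      by (simp add: lines_det_def dot_def algebra_simps)
    ultimately show ?thesis
      using that[of x] by (simp add: b c d add.commute)
  qed
  moreover have P: "line_poly ?D1" "line_poly ?D2" "line_poly ?D3"
    by (intro line_poly_lines_det line_poly_dot_cross line_poly_coord)+
  ultimately obtain x where x: "?D1 x * ?D2 x \<noteq> 0"
    using line_poly_common_nonzero[of ?D1 ?D2] by blast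
  let ?y = "\<lambda>i. if i = c - d then axis 1 1 else if i = 0 then axis 2 1 else axis 3 1 :: 'k ^ 3"
  have "?y (c - d) = axis 1 1" "?y 0 = axis 2 1" "?y (d - c) = axis 3 1"
    using dist by auto
  then have "?D3 ?y \<noteq> 0"
    by (simp only:) (simp add: dot_def axis_def)
  with x obtain z where z: "?D1 z * ?D2 z * ?D3 z \<noteq> 0"
    using line_poly_common_nonzero[of "\<lambda>x. ?D1 x * ?D2 x" ?D3 x ?y, OF line_poly_mult] P by blast
  moreover from z have "z 0 \<noteq> 0"
    by (auto simp: dot_def)
  ultimately show ?thesis
    unfolding meet_tuple_regional_tuple[OF eq] by (intro exI[of _ z]) (simp add: vec_eq_iff)
qed


section \<open>The composite of the two rules\<close>

lemma regional_map_eq_Some_iff: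
  "regional_map R A w = Some u \<longleftrightarrow>
    w \<in> (A + fst R) \<rightarrow>\<^sub>E UNIV \<and> u \<in> A \<rightarrow>\<^sub>E UNIV \<and>
    (\<forall>i\<in>A. snd R (window (fst R) w i) = Some (u i))"
proof -
  obtain S \<phi> where R: "R = (S, \<phi>)" by force
  have "window S w i \<notin> Ind S \<phi> \<longleftrightarrow> \<phi> (window S w i) \<noteq> None" for i
    by (auto simp: Ind_def window_def)
  then show ?thesis
    by (auto simp: R regional_map_def fun_eq_iff PiE_iff extensional_def) (metis option.sel)
qed

text \<open>
  The maps are extended to their largest domains, so that a value of the composite may come from
  representing tuples \<open>G i\<close> and \<open>G'\<close> at a point where the formulas \<open>C\<close> and \<open>C'\<close> vanish. The
  composite of \<open>G'\<close> with the \<open>G i\<close> is nevertheless a polynomial tuple, and it is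
  parallel to \<open>Q\<close> at generic points because the \<open>G i\<close> and \<open>G'\<close> are parallel to \<open>C\<close> and \<open>C'\<close>. Hence it is
  parallel to \<open>Q\<close> everywhere, in particular at the given point.
\<close>

lemma composite_value_parallel:
  fixes w :: "int \<Rightarrow> ('a::alg_closed_field, 'n::finite) proj_space"
    and C :: "(int \<Rightarrow> 'a ^ 'n) \<Rightarrow> 'a ^ 'n"
  assumes S': "finite S'"
    and C: "\<And>G x. represents S G f \<Longrightarrow> parallel (G x) (C x)"
    and C': "\<And>G x. represents S' G f' \<Longrightarrow> parallel (G x) (C' x)" "multihom_tuple S' C'"
    and poly: "\<And>j. line_poly (\<lambda>x. C' (\<lambda>i. C (\<lambda>s. x (i + s))) $ j)"
    and nz: "\<And>x i. C' (\<lambda>i. C (\<lambda>s. x (i + s))) \<noteq> 0 \<Longrightarrow> i \<in> S' \<Longrightarrow> C (\<lambda>s. x (i + s)) \<noteq> 0"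
    and z: "C' (\<lambda>i. C (\<lambda>s. z (i + s))) \<noteq> 0"
    and Q: "\<And>j. line_poly (\<lambda>x. Q x $ j)" "\<And>x. parallel (C' (\<lambda>i. C (\<lambda>s. x (i + s)))) (Q x)"
    and Gu: "\<forall>i\<in>S'. \<exists>G. represents S G f \<and> tuple_map S G (window S w i) = Some (u i)"
    and G': "represents S' G' f'" and G'u: "tuple_map S' G' u = Some p"
  shows "parallel (hom_coords p) (Q (hom_coords \<circ> w))"
proof -
  let ?x = "hom_coords \<circ> w" and ?V = "\<lambda>x i. C (\<lambda>s. x (i + s))"
  from bchoice[OF Gu] obtain G where
    G: "\<And>i. i \<in> S' \<Longrightarrow> represents S (G i) f"
    and Gu: "\<And>i. i \<in> S' \<Longrightarrow> tuple_map S (G i) (window S w i) = Some (u i)"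
    by blast
  have "\<exists>l. l \<noteq> 0 \<and> hom_coords (u i) = l *s G i (\<lambda>s. ?x (i + s))" if i: "i \<in> S'" for i
  proof -
    have "multihom_tuple S (G i)" using G[OF i] by (simp add: represents_def)
    then have "G i (hom_coords \<circ> window S w i) = G i (\<lambda>s. ?x (i + s))"
      by (rule multihom_tuple_cong) (simp add: window_def)
    then have nz: "G i (\<lambda>s. ?x (i + s)) \<noteq> 0" and ui: "u i = proj_point (G i (\<lambda>s. ?x (i + s)))"
      using Gu[OF i] by (auto simp: tuple_map_def split: if_splits)
    show ?thesis
      unfolding ui by (rule hom_coords_proj_point[OF nz]) blast
  qed
  then obtain l where l: "\<And>i. i \<in> S' \<Longrightarrow> l i \<noteq> 0"
    and lG: "\<And>i. i \<in> S' \<Longrightarrow> hom_coords (u i) = l i *s G i (\<lambda>s. ?x (i + s))"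
    by metis
  \<comment> \<open>The constants \<open>l i\<close> make \<open>Y\<close> take exactly the chosen coordinates of the intermediate
      point \<open>u\<close> as its value at \<open>?x\<close>.\<close>
  define Y where "Y x i = (if i \<in> S' then l i *s G i (\<lambda>s. x (i + s)) else hom_coords (u i))"
    for x i
  have Yx: "Y ?x = hom_coords \<circ> u"
    by (simp add: fun_eq_iff Y_def lG)
  have Gpoly: "line_poly (\<lambda>x. G i (\<lambda>s. x (i + s)) $ j)" if "i \<in> S'" for i j
    by (rule line_poly_multihom_tuple[where S = S and G = "G i" and Y = "\<lambda>x s. x (i + s)"])
      (use G[OF that] in \<open>simp_all add: represents_def line_poly_coord\<close>)
  have Ypoly: "line_poly (\<lambda>x. Y x i $ j)" for i j
    unfolding Y_def using line_poly_mult[OF line_poly_const Gpoly]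
    by (cases "i \<in> S'") (simp_all add: line_poly_const)
  have Hpoly: "line_poly (\<lambda>x. G' (Y x) $ j)" for j
    by (rule line_poly_multihom_tuple[where S = S' and G = G' and Y = Y])
      (use G' in \<open>simp_all add: represents_def Ypoly\<close>)
  have generic: "parallel (G' (Y x)) (Q x)"
    if Gx: "\<And>i. i \<in> S' \<Longrightarrow> G i (\<lambda>s. x (i + s)) \<noteq> 0" and D: "C' (?V x) \<noteq> 0" for x
  proof -
    have "\<exists>k. k \<noteq> 0 \<and> Y x i = k *s ?V x i" if i: "i \<in> S'" for i
    proof -
      obtain k where k: "G i (\<lambda>s. x (i + s)) = k *s ?V x i"
        using parallel_imp_scale[OF C[OF G[OF i]] nz[OF D i]] by blast
      then have "k \<noteq> 0" using Gx[OF i] by auto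
      then show ?thesis
        using l[OF i] k i unfolding Y_def
        by (intro exI[of _ "l i * k"]) (simp add: vector_smult_assoc)
    qed
    then obtain k where k: "\<And>i. i \<in> S' \<Longrightarrow> k i \<noteq> 0" "\<And>i. i \<in> S' \<Longrightarrow> Y x i = k i *s ?V x i"
      by metis
    obtain c where "c \<noteq> 0" "C' (Y x) = c *s C' (?V x)"
      by (rule multihom_tuple_scale[OF C'(2) S' k])
    then have "parallel (G' (Y x)) (C' (?V x))"
      using C'(1)[OF G', of "Y x"] by (simp add: parallel_scale_right)
    then show ?thesis
      using Q(2) D by (rule parallel_trans)
  qed
  have "\<exists>j. G i (\<lambda>s. ?x (i + s)) $ j \<noteq> 0" if "i \<in> S'" for i
  proof -
    have "G i (\<lambda>s. ?x (i + s)) \<noteq> 0"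
      using lG[OF that] hom_coords_nonzero[of "u i"] by (metis vector_smult_rzero)
    then show ?thesis by (simp add: vec_eq_iff)
  qed
  then obtain e where e: "\<And>i. i \<in> S' \<Longrightarrow> G i (\<lambda>s. ?x (i + s)) $ e i \<noteq> 0"
    by metis
  obtain e' where e': "C' (?V z) $ e' \<noteq> 0"
    using z by (auto simp: vec_eq_iff)
  have "parallel (G' (Y ?x)) (Q ?x)"
    unfolding parallel_def
  proof (intro allI)
    fix j k
    \<comment> \<open>The open set of generic points: all \<open>G i\<close> and the composite formula are nonzero.\<close>
    let ?F = "\<lambda>t x. case t of None \<Rightarrow> C' (?V x) $ e' | Some i \<Rightarrow> G i (\<lambda>s. x (i + s)) $ e i"
    let ?E = "\<lambda>x. G' (Y x) $ j * Q x $ k - G' (Y x) $ k * Q x $ j"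
    have "?E ?x = 0"
    proof (rule line_poly_vanishes[where I = "insert None (Some ` S')" and F = ?F and E = ?E])
      show "line_poly ?E"
        by (intro line_poly_diff line_poly_mult Q Hpoly)
      show "line_poly (?F t)" if "t \<in> insert None (Some ` S')" for t
        using that poly Gpoly by auto
      show "\<exists>x. ?F t x \<noteq> 0" if "t \<in> insert None (Some ` S')" for t
      proof (cases t)
        case None
        then show ?thesis using e' by auto
      next
        case (Some i)
        then show ?thesis using e[of i] that by (intro exI[of _ ?x]) auto
      qed
      show "?E x = 0" if F: "\<And>t. t \<in> insert None (Some ` S') \<Longrightarrow> ?F t x \<noteq> 0" for x
      proof -
        have "G i (\<lambda>s. x (i + s)) \<noteq> 0" if "i \<in> S'" for i
          using F[of "Some i"] that by auto
        moreover have "C' (?V x) \<noteq> 0"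
          using F[of None] by auto
        ultimately have "parallel (G' (Y x)) (Q x)"
          by (rule generic)
        then show ?thesis by (simp add: parallel_def)
      qed
    qed (use S' in simp)
    then show "G' (Y ?x) $ j * Q ?x $ k = G' (Y ?x) $ k * Q ?x $ j" by simp
  qed
  moreover have nzH: "G' (Y ?x) \<noteq> 0" and p: "p = proj_point (G' (Y ?x))"
    using G'u unfolding Yx by (auto simp: tuple_map_def split: if_splits)
  moreover obtain c where "c \<noteq> 0" "hom_coords p = c *s G' (Y ?x)"
    unfolding p by (rule hom_coords_proj_point[OF nzH])
  ultimately show ?thesis
    by (simp add: parallel_scale_left)
qed

text \<open>
  The composite of the two rational maps as a partial map, before it is extended to its largest
  domain.
\<close>

definition pentagram_composite ::
  "int \<Rightarrow> int \<Rightarrow> int \<Rightarrow> int \<Rightarrow> (int \<Rightarrow> ('k::alg_closed_field, 3) proj_space) \<rightharpoonup> ('k, 3) proj_space" where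
  "pentagram_composite a b c d =
    snd (skew_pentagram (- d) (- b) (- c) (- a)) \<circ>\<^sub>m
    regional_map (skew_pentagram a b c d) {- d, - b, - c, - a}"

lemma pentagram_composite_generic:
  fixes x :: "int \<Rightarrow> ('k::alg_closed_field) ^ 3"
  assumes dist: "distinct [a, b, c, d]" and eq: "b - a = d - c"
    and nz: "meet_tuple (- d) (- b) (- c) (- a) (regional_tuple a b c d x) \<noteq> 0"
  defines "W \<equiv> {a, b, c, d} + {- d, - b, - c, - a}"
  shows "pentagram_composite a b c d (\<lambda>s\<in>W. proj_point (x s)) = Some (proj_point (x 0))"
    and "x 0 \<noteq> 0" and "\<forall>s\<in>W. x s \<noteq> 0"
proof -
  let ?S = "{a, b, c, d}" and ?S' = "{- d, - b, - c, - a}" and ?V = "regional_tuple a b c d x"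
  let ?w = "\<lambda>s\<in>W. proj_point (x s)"
  have W: "i + s \<in> W" if "i \<in> ?S'" "s \<in> ?S" for i s
    unfolding W_def using that by (metis add.commute set_plus_intro)
  have V: "?V i \<noteq> 0" if "i \<in> ?S'" for i
    using meet_tuple_nonzero[OF nz that] .
  show "\<forall>s\<in>W. x s \<noteq> 0"
  proof
    fix t assume "t \<in> W"
    then obtain i s where "i \<in> ?S'" "s \<in> ?S" "t = i + s"
      unfolding W_def by (metis add.commute set_plus_elim)
    then show "x t \<noteq> 0"
      using meet_tuple_nonzero[of a b c d "\<lambda>s. x (i + s)" s] V[of i]
      unfolding regional_tuple_def by blast
  qed
  show x0: "x 0 \<noteq> 0"
    using nz meet_tuple_regional_tuple[OF eq, of x] by auto
  have "snd (skew_pentagram a b c d) (window ?S ?w i) = Some (proj_point (?V i))"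
    if i: "i \<in> ?S'" for i
  proof -
    have "window ?S ?w i = (\<lambda>s\<in>?S. proj_point (x (i + s)))"
      unfolding window_def using W[OF i] by (intro restrict_ext) (simp only: restrict_apply if_True)
    then show ?thesis
      using skew_pentagram_proj_point[OF dist, of "\<lambda>s. x (i + s)"] V[OF i]
      unfolding regional_tuple_def by simp
  qed
  moreover have "?w \<in> ?S' + ?S \<rightarrow>\<^sub>E UNIV"
    unfolding W_def by (simp add: add.commute)
  ultimately have "regional_map (skew_pentagram a b c d) ?S' ?w =
      Some (\<lambda>i\<in>?S'. proj_point (?V i))"
    unfolding regional_map_eq_Some_iff by (simp add: skew_pentagram_def)
  moreover have "distinct [- d, - b, - c, - a]" using dist by auto
  moreover have "proj_point (meet_tuple (- d) (- b) (- c) (- a) ?V) = proj_point (x 0)"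
    using nz unfolding meet_tuple_regional_tuple[OF eq]
    by (intro proj_point_scale) auto
  ultimately show "pentagram_composite a b c d ?w = Some (proj_point (x 0))"
    using skew_pentagram_proj_point[OF _ nz]
    by (simp add: pentagram_composite_def map_comp_def)
qed

lemma generic_formula_pentagram_composite:
  assumes dist: "distinct [a, b, c, d]" and eq: "b - a = d - c"
  shows "generic_formula ({a, b, c, d} + {- d, - b, - c, - a})
    (pentagram_composite a b c d :: _ \<rightharpoonup> ('k::alg_closed_field, 3) proj_space) (\<lambda>x. x 0)"
proof -
  let ?D = "\<lambda>x :: int \<Rightarrow> 'k ^ 3. meet_tuple (- d) (- b) (- c) (- a) (regional_tuple a b c d x)"
  obtain y j where "?D y $ j \<noteq> 0"
    using ex_meet_tuple_regional_tuple_nonzero[OF dist eq] by (metis vec_eq_iff zero_index)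
  moreover have "line_poly (\<lambda>x. ?D x $ j)"
    unfolding regional_tuple_def by (intro line_poly_meet_tuple line_poly_coord)
  moreover have "?D x \<noteq> 0" if "?D x $ j \<noteq> 0" for x
    using that by auto
  ultimately show ?thesis
    unfolding generic_formula_def using pentagram_composite_generic[OF dist eq]
    by (intro exI[of _ "\<lambda>x. ?D x $ j"]) blast
qed

text \<open>
  This makes the coordinate projection one of the tuples that represent the composite. The
  determinants may vanish at \<open>w\<close>, so the explicit formulas do not suffice and
  \<open>composite_value_parallel\<close> is applied with the projection as \<open>Q\<close>.
\<close>

lemma pentagram_composite_value:
  fixes w :: "int \<Rightarrow> ('k::alg_closed_field, 3) proj_space"
  assumes dist: "distinct [a, b, c, d]" and eq: "b - a = d - c"
    and w: "pentagram_composite a b c d w = Some p"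
  shows "p = w 0"
proof -
  let ?S = "{a, b, c, d}" and ?S' = "{- d, - b, - c, - a}"
  let ?V = "\<lambda>(x :: int \<Rightarrow> 'k ^ 3) i. meet_tuple a b c d (\<lambda>s. x (i + s))"
  let ?C' = "meet_tuple (- d) (- b) (- c) (- a) :: (int \<Rightarrow> 'k ^ 3) \<Rightarrow> 'k ^ 3"
  have V: "?V x = regional_tuple a b c d x" for x
    by (simp add: regional_tuple_def fun_eq_iff)
  have dist': "distinct [- d, - b, - c, - a]" using dist by auto
  from w obtain u where u: "regional_map (skew_pentagram a b c d) ?S' w = Some u"
    and p: "snd (skew_pentagram (- d) (- b) (- c) (- a)) u = Some p"
    unfolding pentagram_composite_def map_comp_Some_iff by blast
  have "fst (skew_pentagram a b c d :: ('k, 3) local_rule) = ?S"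
    by (simp add: skew_pentagram_def)
  with u have "\<forall>i\<in>?S'. snd (skew_pentagram a b c d) (window ?S w i) = Some (u i)"
    unfolding regional_map_eq_Some_iff by simp
  then have Gu: "\<forall>i\<in>?S'. \<exists>G. represents ?S G (\<lambda>v. line_meet (v a) (v b) (v c) (v d)) \<and>
      tuple_map ?S G (window ?S w i) = Some (u i)"
    unfolding skew_pentagram_eq_Some_iff[OF dist] .
  from p obtain G' where
    G': "represents ?S' G' (\<lambda>v. line_meet (v (- d)) (v (- b)) (v (- c)) (v (- a)))"
    and G'u: "tuple_map ?S' G' u = Some p"
    unfolding skew_pentagram_eq_Some_iff[OF dist'] by blast
  obtain z where z: "?C' (?V z) \<noteq> 0"
    unfolding V using ex_meet_tuple_regional_tuple_nonzero[OF dist eq] by blast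
  have "parallel (hom_coords p) (hom_coords (w 0))"
  proof (rule composite_value_parallel[where w = w and Q = "\<lambda>x. x 0" and S = ?S and S' = ?S'
        and C = "meet_tuple a b c d" and C' = ?C' and u = u and p = p and G' = G' and z = z
        and f = "\<lambda>v. line_meet (v a) (v b) (v c) (v d)"
        and f' = "\<lambda>v. line_meet (v (- d)) (v (- b)) (v (- c)) (v (- a))", unfolded o_apply])
    show "line_poly (\<lambda>x. ?C' (?V x) $ j)" for j
      by (intro line_poly_meet_tuple line_poly_coord)
    show "?V x i \<noteq> 0" if "?C' (?V x) \<noteq> 0" "i \<in> ?S'" for x i
      using meet_tuple_nonzero[OF that] .
    show "parallel (?C' (?V x)) (x 0)" for x
      unfolding V meet_tuple_regional_tuple[OF eq] by (simp add: parallel_def)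
  qed (fact represents_line_meet_parallel[OF dist] represents_line_meet_parallel[OF dist']
      multihom_meet_tuple[OF dist'] z Gu G' G'u | simp add: line_poly_coord)+
  then show ?thesis
    using proj_point_eq_iff[of "hom_coords p" "hom_coords (w 0)"] by simp
qed

text \<open>
  The projection to the coordinate 0 represents the composite and vanishes nowhere, so the extended
  composite is this projection on the whole product, and the lattice map that it defines is the
  identity without restriction of the domain.
\<close>

lemma compose_skew_pentagram:
  fixes a b c d :: int
  assumes dist: "distinct [a, b, c, d]" and eq: "b - a = d - c"
  shows "composable (skew_pentagram (- d) (- b) (- c) (- a))
      (skew_pentagram a b c d :: ('k::alg_closed_field, 3) local_rule)" (is ?composable)
    and "lattice_map (compose_rule (skew_pentagram (- d) (- b) (- c) (- a))
      (skew_pentagram a b c d :: ('k::alg_closed_field, 3) local_rule)) = Some" (is ?identity)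
proof -
  let ?W = "{a, b, c, d} + {- d, - b, - c, - a}"
  let ?g = "pentagram_composite a b c d :: _ \<rightharpoonup> ('k, 3) proj_space"
  let ?R = "skew_pentagram a b c d :: ('k, 3) local_rule"
  let ?R' = "skew_pentagram (- d) (- b) (- c) (- a) :: ('k, 3) local_rule"
  note gen = generic_formula_pentagram_composite[OF dist eq, where 'k = 'k]
  from gen obtain w p where "?g w = Some p"
    unfolding generic_formula_def by blast
  then obtain u where u: "regional_map ?R {- d, - b, - c, - a} w = Some u" "snd ?R' u = Some p"
    unfolding pentagram_composite_def map_comp_Some_iff by blast
  then have "u \<in> ran (regional_map ?R (fst ?R'))" "u \<notin> Ind (fst ?R') (snd ?R')"
    by (auto simp: ran_def Ind_def skew_pentagram_def)
  then show ?composable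
    unfolding composable_def by (auto simp: case_prod_beta)
  have fin: "finite ?W" by (simp add: finite_set_plus)
  have "0 \<in> ?W" using set_plus_intro[of a "{a, b, c, d}" "- a" "{- d, - b, - c, - a}"] by simp
  then have "multihom_tuple ?W (\<lambda>x. x 0 :: 'k ^ 3)"
    using multihomogeneous_multilinear[OF fin, of "{0}"] unfolding multihom_tuple_def by fastforce
  then have rep: "represents ?W (\<lambda>x. x 0) ?g"
    unfolding represents_def using pentagram_composite_value[OF dist eq, symmetric]
    by (auto simp: tuple_map_def split: if_splits)
  have val: "rational_extension ?W ?g v = Some (v 0)" if "v \<in> ?W \<rightarrow>\<^sub>E UNIV" for v
    unfolding rational_extension_eq_Some_iff[OF gen fin]
    using rep that by (intro exI[of _ "\<lambda>x. x 0"]) (simp add: tuple_map_def)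
  have rule: "compose_rule ?R' ?R = (?W, rational_extension ?W ?g)"
    by (simp add: compose_rule_def skew_pentagram_def pentagram_composite_def)
  have "lattice_map (compose_rule ?R' ?R) v = Some v" for v
  proof -
    have "window ?W v i \<in> ?W \<rightarrow>\<^sub>E UNIV" for i by (simp add: window_def)
    from val[OF this] have "rational_extension ?W ?g (window ?W v i) = Some (v i)" for i
      using \<open>0 \<in> ?W\<close> by (simp add: window_def)
    then show ?thesis
      unfolding rule lattice_map_def by (auto simp: Ind_def)
  qed
  then show ?identity by blast
qed

theorem proposition6p1:
  fixes a b c d :: int
  assumes "distinct [a, b, c, d]"
    and "a < b" and "c < d"
    and "\<bar>b - a\<bar> = \<bar>d - c\<bar>"
  shows "inverse_lattice_maps
           (skew_pentagram a b c d :: ('k::alg_closed_field, 3) local_rule)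
           (skew_pentagram (- d) (- b) (- c) (- a))"
proof -
  \<comment> \<open>The passage from \<open>(a, b, c, d)\<close> to \<open>(- d, - b, - c, - a)\<close> is an involution that preserves
      both hypotheses of \<open>compose_skew_pentagram\<close>, so the second composition is an instance of
      the first.\<close>
  have eq: "b - a = d - c" "- b - - d = - a - - c" using assms by auto
  have dist: "distinct [- d, - b, - c, - a]" using assms(1) by auto
  show ?thesis
    unfolding inverse_lattice_maps_def
    using compose_skew_pentagram[OF assms(1) eq(1), where 'k = 'k]
      compose_skew_pentagram[OF dist eq(2), where 'k = 'k]
      local_rule_skew_pentagram[OF assms(1)] local_rule_skew_pentagram[OF dist]
    by simp
qed

end
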